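(* Let $m\in\mathbb{Z}$ and $N=\begin{pmatrix}1&m\\0&1\end{pmatrix}$. Then the matrices $$A_1=\begin{pmatrix}1&-24m\\0&8\end{pmatrix},\quad A_2=\begin{pmatrix}3&12m\\0&120\end{pmatrix},\quad A_3=\begin{pmatrix}8&-2m\\0&3\end{pmatrix},\quad A_4=\begin{pmatrix}120&6m\\0&1\end{pmatrix}$$ form an upper-triangular Jordan $D(N)$-quadruple consisting of nonsingular matrices.
   Context: $UT_2(\mathbb{Z})$ denotes the ring of upper-triangular $2\times 2$ integer matrices, and $A\circ B=\frac12(AB+BA)$ (computed over $\mathbb{Q}$) is the Jordan product. For $N\in UT_2(\mathbb{Z})$, an upper-triangular Jordan $D(N)$-quadruple is a set of four distinct nonzero matrices $A_1,A_2,A_3,A_4\in UT_2(\mathbb{Z})$ such that for every $1\le i<j\le 4$ there exists $X_{ij}\in UT_2(\mathbb{Z})$ with $A_i\circ A_j+N=X_{ij}^2$. *)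

theory Defs
  imports "HOL-Analysis.Analysis"
begin

(* M $ i $ j is the entry in row i and column j, so mat2 a b c d has rows (a, b) and (c, d). *)
abbreviation mat2 :: "'a \<Rightarrow> 'a \<Rightarrow> 'a \<Rightarrow> 'a \<Rightarrow> ('a::zero)^2^2" where
  "mat2 a b c d \<equiv> vector [vector [a, b], vector [c, d]]"

(* The entry condition is given explicitly because on the index type 2 the numeral 2
   equals 0: the order of that type puts it before 1. *)
definition UT2 :: "(int^2^2) set" where
  "UT2 = {A. A $ 2 $ 1 = 0}"

abbreviation rat_mat :: "int^2^2 \<Rightarrow> rat^2^2" where
  "rat_mat \<equiv> map_matrix rat_of_int"

definition jordan_prod :: "rat^2^2 \<Rightarrow> rat^2^2 \<Rightarrow> rat^2^2" where
  "jordan_prod A B = map_matrix (\<lambda>x. 1 / 2 * x) (A ** B + B ** A)"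

(* As lists the four matrices. A Jordan product of integer matrices may have half-integer
   entries, so the equation is stated over the rationals, with X an integer matrix. *)
definition ut_jordan_D_quadruple :: "int^2^2 \<Rightarrow> (int^2^2) list \<Rightarrow> bool" where
  "ut_jordan_D_quadruple N As \<longleftrightarrow>
     N \<in> UT2 \<and> length As = 4 \<and> distinct As \<and> set As \<subseteq> UT2 \<and> 0 \<notin> set As \<and>
     (\<forall>i j. i < j \<and> j < 4 \<longrightarrow>
        (\<exists>X\<in>UT2. jordan_prod (rat_mat (As ! i)) (rat_mat (As ! j)) + rat_mat N
                 = rat_mat (X ** X)))"

end

theory Submission
  imports Defs
begin

text \<open>
  On upper-triangular matrices the diagonal of the Jordan product is the entrywise product of the
  two diagonals. Both diagonals here run through Fermat's quadruple \<open>{1, 3, 8, 120}\<close>, in which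
  the product of any two elements plus 1 is a square, so the diagonal of \<open>A\<^sub>i \<circ> A\<^sub>j + N\<close>
  consists of two squares \<open>p\<^sup>2\<close> and \<open>q\<^sup>2\<close>. A triangular root with diagonal \<open>p, q\<close> and
  corner \<open>x\<close> then squares to a matrix with corner \<open>(p + q) x\<close>, so all that remains is a
  divisibility by \<open>p + q\<close>. The signs of \<open>p\<close> and \<open>q\<close> are free, and with positive roots this
  divisibility fails for general \<open>m\<close> in all six cases. With opposite signs it holds in
  each: the corners of the \<open>A\<^sub>i\<close> are multiples of \<open>m\<close>, and the corner of \<open>A\<^sub>i \<circ> A\<^sub>j + N\<close> is the
  multiple \<open>-1421 m\<close>, \<open>-140 m\<close>, \<open>-1424 m\<close>, \<open>-56 m\<close>, \<open>1096 m\<close>, \<open>-87 m\<close> in lexicographic order of the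
  pairs, to be divided by \<open>-29, -2, 8, -14, 8, 29\<close> respectively. The criterion
  \<open>triangular_square_root_of_jordan_prod\<close> reduces each pair to this integer arithmetic.
\<close>

lemma mat2_nth [simp]:
  "mat2 a b c d $ 1 $ 1 = a" "mat2 a b c d $ 1 $ 2 = b"
  "mat2 a b c d $ 2 $ 1 = c" "mat2 a b c d $ 2 $ 2 = d"
  by simp_all

lemma mat2_eq_iff:
  "mat2 a b c d = mat2 a' b' c' d' \<longleftrightarrow> a = a' \<and> b = b' \<and> c = c' \<and> d = d'"
  by (metis mat2_nth)

lemma mat2_zero: "0 = (mat2 0 0 0 0 :: ('a::zero)^2^2)"
  by (simp add: vec_eq_iff forall_2)

lemma mat2_UT2 [simp]: "mat2 a b 0 d \<in> UT2"
  by (simp add: UT2_def)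

lemma jordan_prod_triangular:
  "jordan_prod (rat_mat (mat2 a b 0 d)) (rat_mat (mat2 a' b' 0 d')) =
     mat2 (of_int (a * a')) (of_int ((a + d) * b' + (a' + d') * b) / 2) 0 (of_int (d * d'))"
  by (simp add: jordan_prod_def vec_eq_iff forall_2 map_matrix_def matrix_matrix_mult_def sum_2
      algebra_simps add_divide_distrib)

text \<open>Doubling the corner equation clears the denominator of the Jordan product, so that
  the hypotheses are conditions on integers only.\<close>

lemma triangular_square_root_of_jordan_prod:
  fixes a b d a' b' d' k l n p x q :: int
  assumes "a * a' + k = p\<^sup>2" and "d * d' + n = q\<^sup>2"
    and corner: "(a + d) * b' + (a' + d') * b + 2 * l = 2 * ((p + q) * x)"
  shows "\<exists>X\<in>UT2. jordan_prod (rat_mat (mat2 a b 0 d)) (rat_mat (mat2 a' b' 0 d'))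
                 + rat_mat (mat2 k l 0 n) = rat_mat (X ** X)"
proof
  have "rat_of_int (a * a') + of_int k = of_int (p * p)"
    "rat_of_int (d * d') + of_int n = of_int (q * q)"
    using assms(1,2) unfolding power2_eq_square of_int_add[symmetric] by presburger+
  moreover have "rat_of_int ((a + d) * b' + (a' + d') * b) / 2 + of_int l
      = of_int (p * x + x * q)"
  proof -
    have "rat_of_int ((a + d) * b' + (a' + d') * b) + 2 * of_int l = 2 * of_int ((p + q) * x)"
      using arg_cong[OF corner, of rat_of_int] by (simp only: of_int_add of_int_mult of_int_numeral)
    then show ?thesis
      by (simp add: field_simps)
  qed
  ultimately show "jordan_prod (rat_mat (mat2 a b 0 d)) (rat_mat (mat2 a' b' 0 d'))
      + rat_mat (mat2 k l 0 n) = rat_mat (mat2 p x 0 q ** mat2 p x 0 q)"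
    unfolding jordan_prod_triangular
    by (simp add: vec_eq_iff forall_2 map_matrix_def matrix_matrix_mult_def sum_2)
qed simp

theorem proposition10:
  fixes m :: int and N A1 A2 A3 A4 :: "int^2^2"
  assumes "N = mat2 1 m 0 1"
    and "A1 = mat2 1 (-24 * m) 0 8"
    and "A2 = mat2 3 (12 * m) 0 120"
    and "A3 = mat2 8 (-2 * m) 0 3"
    and "A4 = mat2 120 (6 * m) 0 1"
  shows "ut_jordan_D_quadruple N [A1, A2, A3, A4] \<and>
         (\<forall>A \<in> {A1, A2, A3, A4}. det A \<noteq> 0)"
proof
  let ?R = "\<lambda>A B. \<exists>X\<in>UT2. jordan_prod (rat_mat A) (rat_mat B) + rat_mat N = rat_mat (X ** X)"
  have "?R A1 A2"
    unfolding assms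
    by (rule triangular_square_root_of_jordan_prod[where p = 2 and x = "49 * m" and q = "-31"]) simp_all
  moreover have "?R A1 A3"
    unfolding assms
    by (rule triangular_square_root_of_jordan_prod[where p = 3 and x = "70 * m" and q = "-5"]) simp_all
  moreover have "?R A1 A4"
    unfolding assms
    by (rule triangular_square_root_of_jordan_prod[where p = 11 and x = "-178 * m" and q = "-3"]) simp_all
  moreover have "?R A2 A3"
    unfolding assms
    by (rule triangular_square_root_of_jordan_prod[where p = 5 and x = "4 * m" and q = "-19"]) simp_all
  moreover have "?R A2 A4"
    unfolding assms
    by (rule triangular_square_root_of_jordan_prod[where p = 19 and x = "137 * m" and q = "-11"]) simp_all
  moreover have "?R A3 A4"
    unfolding assms
    by (rule triangular_square_root_of_jordan_prod[where p = 31 and x = "-3 * m" and q = "-2"]) simp_all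
  ultimately have roots: "?R ([A1, A2, A3, A4] ! i) ([A1, A2, A3, A4] ! j)"
    if "i < j" "j < 4" for i j
  proof -
    from that have "(i, j) \<in> {(0, 1), (0, 2), (0, 3), (1, 2), (1, 3), (2, 3)}"
      by auto
    with \<open>?R A1 A2\<close> \<open>?R A1 A3\<close> \<open>?R A1 A4\<close> \<open>?R A2 A3\<close> \<open>?R A2 A4\<close> \<open>?R A3 A4\<close> show ?thesis
      by (elim insertE emptyE) (simp_all add: numeral_2_eq_2 numeral_3_eq_3)
  qed
  have "distinct [A1, A2, A3, A4]" and "0 \<notin> set [A1, A2, A3, A4]"
    unfolding assms mat2_zero by (simp_all add: mat2_eq_iff)
  moreover have "N \<in> UT2" and "set [A1, A2, A3, A4] \<subseteq> UT2"
    unfolding assms by simp_all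
  ultimately show "ut_jordan_D_quadruple N [A1, A2, A3, A4]"
    unfolding ut_jordan_D_quadruple_def using roots by simp
  show "\<forall>A \<in> {A1, A2, A3, A4}. det A \<noteq> 0"
    unfolding assms by (simp add: det_2)
qed

end
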